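(* Suppose that $M=(E,\mathcal{I})$ is a finitary matroid, $B_0$ and $B_1$ are bases of $M$, $\kappa$ is a cardinal, and $B_0=\bigcup_{i<\kappa}X_i$ is a partition where each $X_i$ is finite. Then there is a partition $B_1=\bigcup_{i<\kappa}Y_i$ such that $(B_0\setminus X_i)\cup Y_i$ is a base of $M$ for each $i<\kappa$.
   Context: A finitary matroid is a pair $M=(E,\mathcal{I})$ with $\mathcal{I}\subseteq\mathcal{P}(E)$ ($E$ may be infinite) such that: (I) $\emptyset\in\mathcal{I}$; (II) $\mathcal{I}$ is downward closed under $\subseteq$; (III) if $I,J\in\mathcal{I}$ with $|I|<|J|$, then there is an $e\in J\setminus I$ such that $I\cup\{e\}\in\mathcal{I}$; (IV) if all finite subsets of an infinite set $X\subseteq E$ are in $\mathcal{I}$, then $X\in\mathcal{I}$. A base of $M$ is a $\subseteq$-maximal element of $\mathcal{I}$. A partition $B=\bigcup_{i<\kappa}X_i$ means that the sets $X_i$ are pairwise disjoint with union $B$; indices $i<\kappa$ are the ordinals less than $\kappa$. *)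

theory Defs
  imports "HOL-Library.Disjoint_Sets"
begin

unbundle cardinal_syntax

text \<open>In \<open>augmentation\<close>, \<open>|I| <o |J|\<close> compares cardinalities of arbitrary, possibly infinite, sets;
  \<^term>\<open>card\<close> would identify all infinite cardinalities with \<open>0\<close>.\<close>

locale finitary_matroid =
  fixes E :: "'a set" and \<I> :: "'a set set"
  assumes indep_subset_carrier: "\<I> \<subseteq> Pow E"
    and empty_indep: "{} \<in> \<I>"
    and downward_closed: "\<And>I J. J \<in> \<I> \<Longrightarrow> I \<subseteq> J \<Longrightarrow> I \<in> \<I>"
    and augmentation:
      "\<And>I J. I \<in> \<I> \<Longrightarrow> J \<in> \<I> \<Longrightarrow> |I| <o |J| \<Longrightarrow> \<exists>e \<in> J - I. I \<union> {e} \<in> \<I>"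
    and finitary:
      "\<And>X. X \<subseteq> E \<Longrightarrow> infinite X \<Longrightarrow> (\<And>F. F \<subseteq> X \<Longrightarrow> finite F \<Longrightarrow> F \<in> \<I>) \<Longrightarrow> X \<in> \<I>"

definition is_base :: "'a set set \<Rightarrow> 'a set \<Rightarrow> bool" where
  "is_base \<I> B \<longleftrightarrow> B \<in> \<I> \<and> (\<forall>J \<in> \<I>. \<not> B \<subset> J)"

text \<open>Members of an indexed partition may be empty.  The ordinals below a cardinal \<open>\<kappa>\<close> are
  represented by the elements of \<^term>\<open>Field \<kappa>\<close>, where \<open>\<kappa>\<close> is a well-order satisfying
  \<^term>\<open>Card_order \<kappa>\<close>.\<close>

definition indexed_partition :: "'i set \<Rightarrow> ('i \<Rightarrow> 'a set) \<Rightarrow> 'a set \<Rightarrow> bool" where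
  "indexed_partition K X B \<longleftrightarrow> disjoint_family_on X K \<and> (\<Union>i\<in>K. X i) = B"

end

theory Submission
  imports Defs "HOL-Library.Countable_Set"
begin

text \<open>For finite \<open>X \<subseteq> B\<^sub>0\<close>, Rado's rank condition yields a symmetric exchange: some \<open>Y \<subseteq> B\<^sub>1\<close> such that
  \<open>(B\<^sub>0 - X) \<union> Y\<close> and \<open>(B\<^sub>1 - Y) \<union> X\<close> are both bases.  Contracting \<open>X\<close> leaves the bases
  \<open>B\<^sub>0 - X\<close> and \<open>B\<^sub>1 - Y\<close>, so countably many parts can be treated one after the other.  No element
  \<open>b\<close> of \<open>B\<^sub>1\<close> is left over in the end: \<open>b\<close> is spanned by finitely many of the parts, and becomes a
  loop once these have been contracted.

  The iteration cannot simply be continued transfinitely: at a limit stage the parts used so far and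
  the remainder of \<open>B\<^sub>1\<close> need not span.  Instead the index set is exhausted by a well-ordered
  sequence of sets \<open>J\<close> of indices, growing by countable steps, each of which is closed in the sense
  that some subset of \<open>B\<^sub>1\<close> has the same span as the union of the parts indexed by \<open>J\<close>.  Between
  consecutive closed sets the countable case applies.\<close>

section \<open>Independence and rank in contractions of a pregeometry\<close>

text \<open>Contraction by \<open>Z\<close> replaces \<open>cl A\<close> by
  \<open>cl (Z \<union> A)\<close>; there is no separate operation for it, and the later notions
  carry \<open>Z\<close> as a parameter.\<close>

locale pregeometry =
  fixes cl :: "'a set \<Rightarrow> 'a set"
  assumes subset_cl: "A \<subseteq> cl A"
    and cl_mono: "A \<subseteq> B \<Longrightarrow> cl A \<subseteq> cl B"
    and cl_idem: "cl (cl A) = cl A"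
    and cl_finitary: "x \<in> cl A \<Longrightarrow> \<exists>F. finite F \<and> F \<subseteq> A \<and> x \<in> cl F"
    and exchange: "x \<in> cl (insert y A) \<Longrightarrow> x \<notin> cl A \<Longrightarrow> y \<in> cl (insert x A)"
begin

section \<open>Calculus of closures\<close>

lemma cl_subset_iff: "cl A \<subseteq> cl B \<longleftrightarrow> A \<subseteq> cl B"
  by (metis cl_idem cl_mono order_trans subset_cl)

lemma cl_eqI: "A \<subseteq> cl B \<Longrightarrow> B \<subseteq> cl A \<Longrightarrow> cl A = cl B"
  by (simp add: cl_subset_iff subset_antisym)

lemma cl_trans: "x \<in> cl A \<Longrightarrow> A \<subseteq> cl B \<Longrightarrow> x \<in> cl B"
  using cl_subset_iff by blast

lemma in_cl: "x \<in> A \<Longrightarrow> x \<in> cl A"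
  using subset_cl by blast

lemma cl_monoD: "x \<in> cl A \<Longrightarrow> A \<subseteq> B \<Longrightarrow> x \<in> cl B"
  using cl_mono by blast

lemma subset_clI: "A \<subseteq> B \<Longrightarrow> A \<subseteq> cl B"
  using subset_cl by (rule order_trans[rotated])

lemma subset_cl_trans: "A \<subseteq> cl B \<Longrightarrow> B \<subseteq> C \<Longrightarrow> A \<subseteq> cl C"
  by (meson cl_mono order_trans)

text \<open>Only the elements of the finite witnesses that lie in \<open>B\<close> have to be
  collected, since \<open>Z\<close> stays in the spanning set as a whole.\<close>

lemma finite_subset_spanning:
  assumes "finite X" "X \<subseteq> cl (Z \<union> B)"
  obtains S where "finite S" "S \<subseteq> B" "X \<subseteq> cl (Z \<union> S)"
proof -
  have "\<forall>x\<in>X. \<exists>F. finite F \<and> F \<subseteq> Z \<union> B \<and> x \<in> cl F"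
    by (meson assms(2) cl_finitary subsetD)
  then obtain F where "\<forall>x\<in>X. finite (F x) \<and> F x \<subseteq> Z \<union> B \<and> x \<in> cl (F x)"
    by (rule bchoice[THEN exE])
  then have F: "finite (F x)" "F x \<subseteq> Z \<union> B" "x \<in> cl (F x)" if "x \<in> X" for x
    using that by auto
  let ?S = "(\<Union>x\<in>X. F x) \<inter> B"
  have "X \<subseteq> cl (Z \<union> ?S)"
  proof
    fix x assume x: "x \<in> X"
    then have "F x \<subseteq> Z \<union> ?S" using F(2) by blast
    then show "x \<in> cl (Z \<union> ?S)" using F(3)[OF x] by (rule cl_monoD[rotated])
  qed
  moreover have "finite ?S" using F(1) assms(1) by auto
  moreover have "?S \<subseteq> B" by simp
  ultimately show thesis using that by metis
qed

text \<open>Independence in the contraction by \<open>Z\<close>; in particular \<open>A\<close> is disjoint from \<open>Z\<close>.\<close>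

definition indep :: "'a set \<Rightarrow> 'a set \<Rightarrow> bool" where
  "indep Z A \<longleftrightarrow> (\<forall>a\<in>A. a \<notin> cl (Z \<union> (A - {a})))"

lemma indep_empty [simp]: "indep Z {}"
  by (simp add: indep_def)

text \<open>Assuming \<open>Z' \<subseteq> cl Z\<close> instead of \<open>Z' \<subseteq> Z\<close>
  lets sets with equal closure replace each other as contracted sets.\<close>

lemma indep_mono:
  assumes "indep Z A" "B \<subseteq> A" "Z' \<subseteq> cl Z"
  shows "indep Z' B"
  unfolding indep_def
proof (intro ballI notI)
  fix b assume b: "b \<in> B" "b \<in> cl (Z' \<union> (B - {b}))"
  have "Z' \<union> (B - {b}) \<subseteq> cl (Z \<union> (A - {b}))"
    by (intro Un_least subset_cl_trans[OF assms(3)] subset_clI) (use assms(2) in auto)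
  then have "b \<in> cl (Z \<union> (A - {b}))" by (rule cl_trans[OF b(2)])
  then show False using assms(1,2) b(1) unfolding indep_def by blast
qed

lemma indep_subset: "indep Z A \<Longrightarrow> B \<subseteq> A \<Longrightarrow> indep Z B"
  by (meson indep_mono subset_cl)

lemma indep_notin_cl: "indep Z A \<Longrightarrow> a \<in> A \<Longrightarrow> a \<notin> cl Z"
  unfolding indep_def by (meson cl_monoD Un_upper1)

text \<open>If some \<open>b\<close> of \<open>A\<close> became dependent through \<open>a\<close>,
  exchange would place \<open>a\<close> in the closure of \<open>Z \<union> A\<close>.\<close>

lemma indep_insert:
  assumes A: "indep Z A" and a: "a \<notin> cl (Z \<union> A)"
  shows "indep Z (insert a A)"
  unfolding indep_def
proof (intro ballI notI)
  fix b assume b: "b \<in> insert a A" "b \<in> cl (Z \<union> (insert a A - {b}))"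
  have "a \<notin> A" using a in_cl by blast
  show False
  proof (cases "b = a")
    case True
    then show False using b a \<open>a \<notin> A\<close> by simp
  next
    case False
    then have bA: "b \<in> A" using b by blast
    have e: "Z \<union> (insert a A - {b}) = insert a (Z \<union> (A - {b}))" using False by blast
    have "b \<notin> cl (Z \<union> (A - {b}))" using A bA unfolding indep_def by blast
    then have "a \<in> cl (insert b (Z \<union> (A - {b})))"
      using exchange[of b a "Z \<union> (A - {b})"] b(2) e by simp
    moreover have "insert b (Z \<union> (A - {b})) = Z \<union> A" using bA by blast
    ultimately show False using a by simp
  qed
qed

text \<open>Finite parts of \<open>B\<close> can be added one element at a time by
  \<open>indep_insert\<close>, and a dependence in \<open>A \<union> B\<close> involves only
  finitely many elements of \<open>B\<close>.\<close>

lemma indep_Un: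
  assumes A: "indep Z A" and B: "indep (Z \<union> A) B"
  shows "indep Z (A \<union> B)"
proof -
  have fin: "indep Z (A \<union> C)" if "finite C" "C \<subseteq> B" for C
    using that
  proof (induction C rule: finite_induct)
    case empty
    then show ?case using A by simp
  next
    case (insert c C)
    have "c \<notin> cl (Z \<union> A \<union> (B - {c}))" using B insert.prems unfolding indep_def by blast
    moreover have "Z \<union> (A \<union> C) \<subseteq> Z \<union> A \<union> (B - {c})" using insert by blast
    ultimately have "c \<notin> cl (Z \<union> (A \<union> C))" by (meson cl_monoD)
    then show ?case using indep_insert[of Z "A \<union> C" c] insert.IH insert.prems by simp
  qed
  show ?thesis
    unfolding indep_def
  proof (intro ballI notI)
    fix a assume a: "a \<in> A \<union> B" "a \<in> cl (Z \<union> (A \<union> B - {a}))"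
    obtain F where F: "finite F" "F \<subseteq> Z \<union> (A \<union> B - {a})" "a \<in> cl F"
      using cl_finitary[OF a(2)] by blast
    let ?C = "insert a F \<inter> B"
    have "indep Z (A \<union> ?C)" by (rule fin) (use F(1) in auto)
    moreover have "a \<in> A \<union> ?C" using a by blast
    moreover have "F \<subseteq> Z \<union> (A \<union> ?C - {a})" using F(2) by blast
    ultimately show False unfolding indep_def by (meson F(3) cl_monoD)
  qed
qed

text \<open>Reverse direction to \<open>indep_Un\<close>. Disjointness keeps the elements of
  \<open>B\<close> out of the contracted set, where they would be loops.\<close>

lemma indep_contract:
  assumes "indep Z (A \<union> B)" "A \<inter> B = {}"
  shows "indep (Z \<union> A) B"
  unfolding indep_def
proof (intro ballI notI)
  fix b assume b: "b \<in> B" "b \<in> cl (Z \<union> A \<union> (B - {b}))"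
  have "Z \<union> A \<union> (B - {b}) = Z \<union> (A \<union> B - {b})" using assms(2) b(1) by blast
  then show False using assms(1) b unfolding indep_def by simp
qed

lemma indep_contract_Diff: "indep Z B \<Longrightarrow> A \<subseteq> B \<Longrightarrow> indep (Z \<union> A) (B - A)"
  by (rule indep_contract) (simp_all add: Un_absorb1)

section \<open>Steinitz bound and rank of finite sets\<close>

lemma steinitz:
  assumes "finite F" "indep Z A" "A \<subseteq> cl (Z \<union> F)"
  shows "finite A \<and> card A \<le> card F"
  using assms
proof (induction F arbitrary: Z A rule: finite_induct)
  case empty
  then have "A = {}" using indep_notin_cl by fastforce
  then show ?case by simp
next
  case (insert f F)
  have eq: "Z \<union> insert f F = insert f Z \<union> F" by blast
  \<comment> \<open>Contracting \<open>f\<close> either keeps \<open>A\<close> independent or costs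
    one element \<open>a\<close>, for which \<open>f\<close> is substituted; hence \<open>Z\<close>
    and \<open>A\<close> vary in the induction.\<close>
  show ?case
  proof (cases "indep (insert f Z) A")
    case True
    then show ?thesis using insert.IH[OF True] insert eq by fastforce
  next
    case False
    then obtain a where a: "a \<in> A" "a \<in> cl (insert f Z \<union> (A - {a}))"
      unfolding indep_def by blast
    have na: "a \<notin> cl (Z \<union> (A - {a}))" using insert.prems(1) a(1) unfolding indep_def by blast
    have nf: "f \<notin> cl (Z \<union> (A - {a}))"
    proof
      assume "f \<in> cl (Z \<union> (A - {a}))"
      then have "insert f Z \<union> (A - {a}) \<subseteq> cl (Z \<union> (A - {a}))"
        using subset_cl[of "Z \<union> (A - {a})"] by simp
      then show False using na cl_trans[OF a(2)] by simp
    qed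
    have "indep Z (insert f (A - {a}))"
      by (rule indep_insert[OF indep_subset[OF insert.prems(1)] nf]) simp
    moreover have "f \<notin> A - {a}" using nf in_cl[of f "Z \<union> (A - {a})"] by blast
    ultimately have "indep (insert f Z) (A - {a})"
      using indep_contract[of Z "{f}" "A - {a}"] by simp
    moreover have "A - {a} \<subseteq> cl (insert f Z \<union> F)" using insert.prems(2) eq by auto
    ultimately have "finite (A - {a}) \<and> card (A - {a}) \<le> card F" by (rule insert.IH)
    then show ?thesis using a(1) insert(1,2) by (auto simp: card_Diff_singleton_if)
  qed
qed

text \<open>Meaningful for finite \<open>T\<close>, where the maximum is over a finite nonempty set;
  \<open>Z\<close> may be infinite.\<close>

definition rk :: "'a set \<Rightarrow> 'a set \<Rightarrow> nat" where
  "rk Z T = Max (card ` {A. A \<subseteq> T \<and> indep Z A})"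

lemma card_le_rk: "finite T \<Longrightarrow> A \<subseteq> T \<Longrightarrow> indep Z A \<Longrightarrow> card A \<le> rk Z T"
  unfolding rk_def by (rule Max_ge) auto

lemma rk_attained:
  assumes "finite T"
  obtains A where "A \<subseteq> T" "indep Z A" "card A = rk Z T"
proof -
  have "rk Z T \<in> card ` {A. A \<subseteq> T \<and> indep Z A}"
    unfolding rk_def using assms by (intro Max_in) (auto intro: exI[of _ "{}"])
  then show thesis using that by auto
qed

lemma spanning_if_card_eq_rk:
  assumes "finite T" "A \<subseteq> T" "indep Z A" "card A = rk Z T"
  shows "T \<subseteq> cl (Z \<union> A)"
proof
  fix t assume t: "t \<in> T"
  show "t \<in> cl (Z \<union> A)"
  proof (rule ccontr)
    assume n: "t \<notin> cl (Z \<union> A)"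
    then have "indep Z (insert t A)" using indep_insert assms(3) by blast
    then have "card (insert t A) \<le> rk Z T" using card_le_rk assms t by blast
    moreover have "t \<notin> A" using n in_cl by blast
    ultimately show False using assms finite_subset by fastforce
  qed
qed

lemma rk_basis:
  assumes "finite T"
  obtains A where "A \<subseteq> T" "indep Z A" "card A = rk Z T" "T \<subseteq> cl (Z \<union> A)"
  by (metis assms rk_attained spanning_if_card_eq_rk)

lemma rk_eq_card:
  assumes "finite T" "A \<subseteq> T" "indep Z A" "T \<subseteq> cl (Z \<union> A)"
  shows "rk Z T = card A"
proof -
  obtain B where "B \<subseteq> T" "indep Z B" "card B = rk Z T" using rk_attained assms(1) by blast
  then have "rk Z T \<le> card A"
    using steinitz[of A Z B] assms finite_subset by (metis order_trans)
  then show ?thesis using card_le_rk assms(1-3) le_antisym by blast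
qed

lemma rk_indep: "finite A \<Longrightarrow> indep Z A \<Longrightarrow> rk Z A = card A"
  by (rule rk_eq_card) (auto intro: in_cl)

lemma rk_eq_0: "finite T \<Longrightarrow> T \<subseteq> cl Z \<Longrightarrow> rk Z T = 0"
  using rk_eq_card[of T "{}" Z] by simp

lemma rk_mono: "finite T \<Longrightarrow> S \<subseteq> T \<Longrightarrow> rk Z S \<le> rk Z T"
  by (metis card_le_rk finite_subset order_trans rk_attained)

lemma rk_antimono: "finite T \<Longrightarrow> Z \<subseteq> W \<Longrightarrow> rk W T \<le> rk Z T"
  by (metis card_le_rk indep_mono order_refl order_trans rk_attained subset_cl)

text \<open>Chain rule: a basis of \<open>T\<close> over \<open>Z\<close> together with a basis of
  \<open>U\<close> over \<open>Z \<union> T\<close> is a basis of the union over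
  \<open>Z\<close>.\<close>

lemma rk_Un:
  assumes "finite T" "finite U"
  shows "rk Z (T \<union> U) = rk Z T + rk (Z \<union> T) U"
proof -
  obtain A where A: "A \<subseteq> T" "indep Z A" "card A = rk Z T" "T \<subseteq> cl (Z \<union> A)"
    using rk_basis assms(1) by blast
  obtain B where B: "B \<subseteq> U" "indep (Z \<union> T) B" "card B = rk (Z \<union> T) U" "U \<subseteq> cl (Z \<union> T \<union> B)"
    using rk_basis assms(2) by blast
  have "Z \<union> A \<subseteq> cl (Z \<union> T)" using A(1) subset_cl[of "Z \<union> T"] by blast
  then have "indep (Z \<union> A) B" using B(2) indep_mono by blast
  then have i: "indep Z (A \<union> B)" using indep_Un A(2) by blast
  have "A \<inter> B = {}" using B(2) A(1) indep_notin_cl in_cl by blast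
  then have c: "card (A \<union> B) = card A + card B"
    using A(1) B(1) assms by (meson card_Un_disjoint finite_subset)
  have T: "T \<subseteq> cl (Z \<union> (A \<union> B))" using A(4) cl_mono[of "Z \<union> A" "Z \<union> (A \<union> B)"] by blast
  then have "Z \<union> T \<union> B \<subseteq> cl (Z \<union> (A \<union> B))" using subset_cl[of "Z \<union> (A \<union> B)"] by blast
  then have "U \<subseteq> cl (Z \<union> (A \<union> B))" using B(4) cl_subset_iff by blast
  then have "rk Z (T \<union> U) = card (A \<union> B)"
    using rk_eq_card[of "T \<union> U" "A \<union> B" Z] i T A(1) B(1) assms by blast
  then show ?thesis using c A(3) B(3) by simp
qed

text \<open>The chain rule reduces the claim to comparing the rank of \<open>A\<close> after
  contracting \<open>B\<close> and after contracting \<open>A \<inter> B\<close>; contracting more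
  cannot raise it.\<close>

lemma rk_submodular:
  assumes "finite A" "finite B"
  shows "rk Z (A \<union> B) + rk Z (A \<inter> B) \<le> rk Z A + rk Z B"
proof -
  have 1: "rk Z (A \<union> B) = rk Z B + rk (Z \<union> B) A"
    using rk_Un[of B A Z] assms by (simp add: Un_commute)
  have "(A \<inter> B) \<union> A = A" by blast
  then have 2: "rk Z A = rk Z (A \<inter> B) + rk (Z \<union> (A \<inter> B)) A"
    using rk_Un[of "A \<inter> B" A Z] assms by simp
  have "rk (Z \<union> B) A \<le> rk (Z \<union> (A \<inter> B)) A"
    by (rule rk_antimono) (use assms in auto)
  then show ?thesis using 1 2 by simp
qed

lemma rk_singleton: "rk Z {e} = (if e \<in> cl Z then 0 else 1)"
  using rk_eq_0[of "{e}" Z] rk_indep[of "{e}" Z] by (auto simp: indep_def)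

lemma rk_insert: "finite T \<Longrightarrow> rk Z (insert e T) = rk Z T + (if e \<in> cl (Z \<union> T) then 0 else 1)"
  using rk_Un[of T "{e}" Z] by (simp add: rk_singleton)

section \<open>Exchange of finite, countable and arbitrary families\<close>

text \<open>Contracting the non-loop \<open>e\<close> lowers the rank of \<open>T\<close> exactly
  when \<open>e\<close> lies in \<open>cl (Z \<union> T)\<close>, and then by one. In the
  application \<open>m\<close> is the rank of \<open>T\<close> in the other contraction.\<close>

lemma tight_if_violated:
  assumes "finite T" and le: "card T \<le> rk Z T + m"
    and e: "e \<notin> cl Z" and viol: "rk (insert e Z) T + m < card T"
  shows "e \<in> cl (Z \<union> T) \<and> card T = rk Z T + m"
proof -
  have "rk Z (insert e T) = 1 + rk (insert e Z) T"
    using rk_Un[of "{e}" T Z] assms(1) e by (simp add: rk_singleton)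
  then show ?thesis using rk_insert[OF assms(1), of Z e] le viol by (auto split: if_splits)
qed

text \<open>If an element \<open>e\<close> fits into neither part, then \<open>e\<close> lies in the closure of a tight set (one with
  equality in the rank condition) on either side.  By submodularity the union \<open>T\<close> of the two tight
  sets is tight, so \<open>insert e T\<close> violates the rank condition.\<close>

lemma matroid_partition:
  assumes "finite S" and "\<And>T. T \<subseteq> S \<Longrightarrow> card T \<le> rk Z\<^sub>1 T + rk Z\<^sub>2 T"
  shows "\<exists>Y\<subseteq>S. indep Z\<^sub>1 Y \<and> indep Z\<^sub>2 (S - Y)"
  using assms
proof (induction S arbitrary: Z\<^sub>1 Z\<^sub>2 rule: finite_induct)
  case empty
  then show ?case by simp
next
  case (insert e S)
  have le: "card T \<le> rk Z\<^sub>1 T + rk Z\<^sub>2 T" if "T \<subseteq> S" for T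
    using insert.prems that by blast
  have finS: "finite T" if "T \<subseteq> S" for T using that insert(1) finite_subset by blast
  \<comment> \<open>Placing \<open>e\<close> in one of the parts amounts to contracting it there, so
    the rank condition for \<open>S\<close> must survive this contraction. In the third case each
    side has \<open>e\<close> as a loop or loses the condition.\<close>
  consider
    (1) "e \<notin> cl Z\<^sub>1" "\<And>T. T \<subseteq> S \<Longrightarrow> card T \<le> rk (insert e Z\<^sub>1) T + rk Z\<^sub>2 T"
  | (2) "e \<notin> cl Z\<^sub>2" "\<And>T. T \<subseteq> S \<Longrightarrow> card T \<le> rk Z\<^sub>1 T + rk (insert e Z\<^sub>2) T"
  | (3) "e \<in> cl Z\<^sub>1 \<or> (\<exists>T\<subseteq>S. rk (insert e Z\<^sub>1) T + rk Z\<^sub>2 T < card T)"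
        "e \<in> cl Z\<^sub>2 \<or> (\<exists>T\<subseteq>S. rk Z\<^sub>1 T + rk (insert e Z\<^sub>2) T < card T)"
    by (meson not_le)
  then show ?case
  proof cases
    case 1
    obtain Y where Y: "Y \<subseteq> S" "indep (insert e Z\<^sub>1) Y" "indep Z\<^sub>2 (S - Y)"
      using insert.IH[OF 1(2)] by blast
    have "indep Z\<^sub>1 {e}" using 1(1) by (simp add: indep_def)
    then have "indep Z\<^sub>1 (insert e Y)" using indep_Un[of Z\<^sub>1 "{e}" Y] Y(2) by simp
    moreover have "insert e S - insert e Y = S - Y" using insert(2) by blast
    ultimately show ?thesis using Y by (metis insert_mono)
  next
    case 2
    obtain Y where Y: "Y \<subseteq> S" "indep Z\<^sub>1 Y" "indep (insert e Z\<^sub>2) (S - Y)"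
      using insert.IH[OF 2(2)] by blast
    have "indep Z\<^sub>2 {e}" using 2(1) by (simp add: indep_def)
    then have "indep Z\<^sub>2 (insert e (S - Y))" using indep_Un[of Z\<^sub>2 "{e}" "S - Y"] Y(3) by simp
    moreover have "insert e S - Y = insert e (S - Y)" using insert(2) Y(1) by blast
    ultimately show ?thesis using Y by (metis subset_insertI2)
  next
    case 3
    have "\<exists>T\<subseteq>S. e \<in> cl (Z\<^sub>1 \<union> T) \<and> card T = rk Z\<^sub>1 T + rk Z\<^sub>2 T"
    proof (cases "e \<in> cl Z\<^sub>1")
      case True
      \<comment> \<open>For a loop \<open>e\<close> the empty set is tight.\<close>
      then show ?thesis by (intro exI[of _ "{}"]) (simp add: rk_eq_0)
    next
      case False
      then show ?thesis using 3(1) tight_if_violated[OF finS le False] by blast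
    qed
    then obtain T\<^sub>1 where T1: "T\<^sub>1 \<subseteq> S" "e \<in> cl (Z\<^sub>1 \<union> T\<^sub>1)" "card T\<^sub>1 = rk Z\<^sub>1 T\<^sub>1 + rk Z\<^sub>2 T\<^sub>1"
      by blast
    have "\<exists>T\<subseteq>S. e \<in> cl (Z\<^sub>2 \<union> T) \<and> card T = rk Z\<^sub>1 T + rk Z\<^sub>2 T"
    proof (cases "e \<in> cl Z\<^sub>2")
      case True
      then show ?thesis by (intro exI[of _ "{}"]) (simp add: rk_eq_0)
    next
      case False
      then obtain T where T: "T \<subseteq> S" "rk Z\<^sub>1 T + rk (insert e Z\<^sub>2) T < card T" using 3(2) by blast
      show ?thesis
        using tight_if_violated[OF finS[OF T(1)], of Z\<^sub>2 "rk Z\<^sub>1 T" e] False T le[OF T(1)]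
        by (metis add.commute)
    qed
    then obtain T\<^sub>2 where T2: "T\<^sub>2 \<subseteq> S" "e \<in> cl (Z\<^sub>2 \<union> T\<^sub>2)" "card T\<^sub>2 = rk Z\<^sub>1 T\<^sub>2 + rk Z\<^sub>2 T\<^sub>2"
      by blast
    let ?T = "T\<^sub>1 \<union> T\<^sub>2"
    have T: "?T \<subseteq> S" "finite ?T" using T1 T2 finS by auto
    have "card ?T + card (T\<^sub>1 \<inter> T\<^sub>2) = card T\<^sub>1 + card T\<^sub>2"
      using card_Un_Int[of T\<^sub>1 T\<^sub>2] finS T1 T2 by simp
    moreover have "rk Z\<^sub>1 ?T + rk Z\<^sub>1 (T\<^sub>1 \<inter> T\<^sub>2) \<le> rk Z\<^sub>1 T\<^sub>1 + rk Z\<^sub>1 T\<^sub>2"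
      and "rk Z\<^sub>2 ?T + rk Z\<^sub>2 (T\<^sub>1 \<inter> T\<^sub>2) \<le> rk Z\<^sub>2 T\<^sub>1 + rk Z\<^sub>2 T\<^sub>2"
      using rk_submodular T(2) by auto
    \<comment> \<open>The rank condition for the intersection turns the submodular bounds into
      tightness of the union.\<close>
    moreover have "card (T\<^sub>1 \<inter> T\<^sub>2) \<le> rk Z\<^sub>1 (T\<^sub>1 \<inter> T\<^sub>2) + rk Z\<^sub>2 (T\<^sub>1 \<inter> T\<^sub>2)"
      using le T1(1) by blast
    ultimately have tight: "rk Z\<^sub>1 ?T + rk Z\<^sub>2 ?T \<le> card ?T" using T1(3) T2(3) by linarith
    have "e \<in> cl (Z\<^sub>1 \<union> ?T)" "e \<in> cl (Z\<^sub>2 \<union> ?T)"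
      using cl_monoD[OF T1(2), of "Z\<^sub>1 \<union> ?T"] cl_monoD[OF T2(2), of "Z\<^sub>2 \<union> ?T"] by blast+
    then have "rk Z\<^sub>1 (insert e ?T) + rk Z\<^sub>2 (insert e ?T) \<le> card ?T"
      using tight rk_insert[OF T(2)] by simp
    moreover have "card (insert e ?T) \<le> rk Z\<^sub>1 (insert e ?T) + rk Z\<^sub>2 (insert e ?T)"
      using insert.prems T(1) by blast
    moreover have "e \<notin> ?T" using T(1) insert(2) by blast
    ultimately show ?thesis using T(2) by simp
  qed
qed

text \<open>\<open>Y\<close> comes from splitting a finite \<open>S \<subseteq> B\<^sub>1\<close>
  that spans \<open>X\<close> over \<open>Z\<close>. By \<open>matroid_partition\<close>,
  \<open>Y\<close> is independent over \<open>Z \<union> (B\<^sub>0 - X)\<close> and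
  \<open>S - Y\<close> over \<open>Z \<union> X\<close>; counting then shows that \<open>Y\<close>
  spans \<open>X\<close> and \<open>S - Y\<close> spans \<open>S\<close> in these
  contractions.\<close>

lemma multiple_exchange:
  assumes B0: "indep Z B\<^sub>0" and B1: "indep Z B\<^sub>1" and cl01: "cl (Z \<union> B\<^sub>0) = cl (Z \<union> B\<^sub>1)"
    and X: "finite X" "X \<subseteq> B\<^sub>0"
  obtains Y where "Y \<subseteq> B\<^sub>1"
    "indep (Z \<union> (B\<^sub>0 - X)) Y" "cl (Z \<union> (B\<^sub>0 - X) \<union> Y) = cl (Z \<union> B\<^sub>0)"
    "indep (Z \<union> X) (B\<^sub>1 - Y)" "cl (Z \<union> X \<union> (B\<^sub>1 - Y)) = cl (Z \<union> B\<^sub>0)"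
proof -
  let ?W = "Z \<union> (B\<^sub>0 - X)"
  have X1: "X \<subseteq> cl (Z \<union> B\<^sub>1)" using X(2) subset_cl[of "Z \<union> B\<^sub>0"] cl01 by blast
  obtain S where S: "finite S" "S \<subseteq> B\<^sub>1" "X \<subseteq> cl (Z \<union> S)"
    using finite_subset_spanning[OF X(1) X1] by blast
  have WX: "?W \<union> X = Z \<union> B\<^sub>0" using X(2) by blast
  have iX: "indep Z X" using B0 X(2) indep_subset by blast
  have iWX: "indep ?W X"
    using indep_contract[of Z "B\<^sub>0 - X" X] B0 X(2) by (simp add: Un_absorb2 Int_commute)
  \<comment> \<open>submodularity of the rank, stated with relative ranks because \<open>?W\<close> may be infinite\<close>
  have le: "card T \<le> rk ?W T + rk (Z \<union> X) T" if "T \<subseteq> S" for T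
  proof -
    have T: "finite T" "indep Z T"
      using that S(1,2) finite_subset indep_subset[OF B1] by blast+
    have "card T + rk (Z \<union> T) X = card X + rk (Z \<union> X) T"
      using rk_Un[of T X Z] rk_Un[of X T Z] T X(1) rk_indep iX by (simp add: Un_commute)
    moreover have "card X \<le> rk ?W T + rk (?W \<union> T) X"
      using rk_Un[of T X ?W] T X(1) rk_indep[OF X(1) iWX] rk_mono[of "T \<union> X" X ?W] by simp
    moreover have "rk (?W \<union> T) X \<le> rk (Z \<union> T) X"
      by (rule rk_antimono) (use X in auto)
    ultimately show ?thesis by linarith
  qed
  obtain Y where Y: "Y \<subseteq> S" "indep ?W Y" "indep (Z \<union> X) (S - Y)"
    using matroid_partition[OF S(1) le] by blast
  have finY: "finite Y" using Y(1) S(1) finite_subset by blast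
  have Y0: "Y \<subseteq> cl (?W \<union> X)"
    using Y(1) S(2) WX cl01 subset_cl[of "Z \<union> B\<^sub>1"] by auto
  have rX: "rk ?W (X \<union> Y) = card X"
    by (rule rk_eq_card) (use X finY iWX Y0 in_cl in auto)
  \<comment> \<open>\<open>S\<close> spans \<open>X\<close>, so the rank of
    \<open>S \<union> X\<close> over \<open>Z\<close> is \<open>card S\<close>; the chain rule in
    the other order gives the right-hand side.\<close>
  have rS: "card S = card X + rk (Z \<union> X) S"
    using rk_Un[of S X Z] rk_Un[of X S Z] S(1) X(1) rk_indep iX indep_subset[OF B1 S(2)]
      rk_eq_0[OF X(1) S(3)] by (simp add: Un_commute)
  have "card Y \<le> card X"
    using card_le_rk[of "X \<union> Y" Y ?W] X(1) finY Y(2) rX by simp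
  moreover have "card (S - Y) \<le> rk (Z \<union> X) S" using card_le_rk S(1) Y(3) by blast
  moreover have "card S = card Y + card (S - Y)"
    using Y(1) S(1) by (simp add: card_Diff_subset card_mono finY)
  \<comment> \<open>The two upper bounds add up to \<open>card S\<close>, and so do the two
    cardinalities; hence both bounds are attained.\<close>
  ultimately have eq: "card Y = card X" "card (S - Y) = rk (Z \<union> X) S" using rS by linarith+
  have XY: "X \<subseteq> cl (?W \<union> Y)"
    using spanning_if_card_eq_rk[of "X \<union> Y" Y ?W] X(1) finY Y(2) rX eq(1) by simp
  have c1: "cl (?W \<union> Y) = cl (Z \<union> B\<^sub>0)"
  proof (rule cl_eqI)
    show "?W \<union> Y \<subseteq> cl (Z \<union> B\<^sub>0)"
      using Y0 WX subset_cl[of "Z \<union> B\<^sub>0"] by auto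
    show "Z \<union> B\<^sub>0 \<subseteq> cl (?W \<union> Y)" using XY subset_cl[of "?W \<union> Y"] by blast
  qed
  have SY: "S \<subseteq> cl (Z \<union> X \<union> (S - Y))"
    using spanning_if_card_eq_rk[OF S(1) _ Y(3) eq(2)] by blast
  \<comment> \<open>The rest of \<open>B\<^sub>1\<close> is independent over
    \<open>Z \<union> S\<close>, whose closure contains \<open>X\<close> and
    \<open>S - Y\<close>.\<close>
  have "indep (Z \<union> S) (B\<^sub>1 - S)" using indep_contract_Diff B1 S(2) by blast
  moreover have "Z \<union> X \<union> (S - Y) \<subseteq> cl (Z \<union> S)"
    using S(3) subset_cl[of "Z \<union> S"] by blast
  ultimately have "indep (Z \<union> X \<union> (S - Y)) (B\<^sub>1 - S)" using indep_mono by blast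
  then have "indep (Z \<union> X) ((S - Y) \<union> (B\<^sub>1 - S))" using indep_Un Y(3) by blast
  moreover have "(S - Y) \<union> (B\<^sub>1 - S) = B\<^sub>1 - Y" using Y(1) S(2) by blast
  ultimately have i2: "indep (Z \<union> X) (B\<^sub>1 - Y)" by simp
  have c2: "cl (Z \<union> X \<union> (B\<^sub>1 - Y)) = cl (Z \<union> B\<^sub>0)"
    unfolding cl01
  proof (rule cl_eqI)
    show "Z \<union> X \<union> (B\<^sub>1 - Y) \<subseteq> cl (Z \<union> B\<^sub>1)"
      using X1 subset_cl[of "Z \<union> B\<^sub>1"] by blast
    have "cl (Z \<union> X \<union> (S - Y)) \<subseteq> cl (Z \<union> X \<union> (B\<^sub>1 - Y))"
      by (rule cl_mono) (use S(2) in blast)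
    then have "S \<subseteq> cl (Z \<union> X \<union> (B\<^sub>1 - Y))" using SY by blast
    then show "Z \<union> B\<^sub>1 \<subseteq> cl (Z \<union> X \<union> (B\<^sub>1 - Y))"
      using subset_cl[of "Z \<union> X \<union> (B\<^sub>1 - Y)"] Y(1) by blast
  qed
  show thesis using that Y(1) S(2) Y(2) c1 i2 c2 by blast
qed

text \<open>Over \<open>Z \<union> V n\<close>, with \<open>V n\<close> the union of the parts
  already exchanged, \<open>B\<^sub>0 - V n\<close> and the remainder of \<open>B\<^sub>1\<close>
  are independent with equal closure, so \<open>multiple_exchange\<close> applies again.\<close>

lemma sequential_exchange:
  fixes X :: "nat \<Rightarrow> 'a set"
  assumes B0: "indep Z B\<^sub>0" and B1: "indep Z B\<^sub>1" and cl01: "cl (Z \<union> B\<^sub>0) = cl (Z \<union> B\<^sub>1)"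
    and fin: "\<And>n. finite (X n)" and disj: "disjoint_family X" and un: "(\<Union>n. X n) = B\<^sub>0"
  obtains Y where "disjoint_family Y" "(\<Union>n. Y n) = B\<^sub>1"
    "\<And>n. indep (Z \<union> (B\<^sub>0 - X n)) (Y n)" "\<And>n. cl (Z \<union> (B\<^sub>0 - X n) \<union> Y n) = cl (Z \<union> B\<^sub>0)"
proof -
  define V where "V n = (\<Union>m<n. X m)" for n
  have V0: "V 0 = {}" and VS: "V (Suc n) = V n \<union> X n" for n
    by (auto simp: V_def less_Suc_eq)
  have VB: "V n \<subseteq> B\<^sub>0" for n using un by (auto simp: V_def)
  have VX: "V n \<inter> X n = {}" for n
  proof -
    have "X m \<inter> X n = {}" if "m < n" for m
      using disj that unfolding disjoint_family_on_def by simp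
    then show ?thesis unfolding V_def by blast
  qed
  \<comment> \<open>\<open>R\<close> is what remains of \<open>B\<^sub>1\<close> after the parts \<open>X m\<close> with \<open>m < n\<close> have been exchanged\<close>
  define P where "P n R \<longleftrightarrow> R \<subseteq> B\<^sub>1 \<and> indep (Z \<union> V n) R \<and> cl (Z \<union> V n \<union> R) = cl (Z \<union> B\<^sub>0)" for n R
  define Q where "Q n R R' \<longleftrightarrow> R' \<subseteq> R \<and> indep (Z \<union> (B\<^sub>0 - X n)) (R - R')
    \<and> cl (Z \<union> (B\<^sub>0 - X n) \<union> (R - R')) = cl (Z \<union> B\<^sub>0)" for n R R'
  have step: "\<exists>R'. P (Suc n) R' \<and> Q n R R'" if R: "P n R" for n R
  proof -
    have i0: "indep (Z \<union> V n) (B\<^sub>0 - V n)" using indep_contract_Diff B0 VB by blast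
    have e0: "Z \<union> V n \<union> (B\<^sub>0 - V n) = Z \<union> B\<^sub>0" using VB by blast
    have c: "cl (Z \<union> V n \<union> (B\<^sub>0 - V n)) = cl (Z \<union> V n \<union> R)" using R e0 by (simp add: P_def)
    have Xs: "X n \<subseteq> B\<^sub>0 - V n" using un VX by blast
    have iR: "indep (Z \<union> V n) R" using R by (simp add: P_def)
    obtain Y where Y: "Y \<subseteq> R" "indep (Z \<union> V n \<union> (B\<^sub>0 - V n - X n)) Y"
      "cl (Z \<union> V n \<union> (B\<^sub>0 - V n - X n) \<union> Y) = cl (Z \<union> V n \<union> (B\<^sub>0 - V n))"
      "indep (Z \<union> V n \<union> X n) (R - Y)"
      "cl (Z \<union> V n \<union> X n \<union> (R - Y)) = cl (Z \<union> V n \<union> (B\<^sub>0 - V n))"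
      by (rule multiple_exchange[OF i0 iR c fin Xs]) (rule that; assumption)
    \<comment> \<open>The contracted parts \<open>V n\<close> count as present, so the local
      exchange is already the required one in the whole of \<open>B\<^sub>0\<close>.\<close>
    have e: "Z \<union> V n \<union> (B\<^sub>0 - V n - X n) = Z \<union> (B\<^sub>0 - X n)" using VB VX by blast
    have "P (Suc n) (R - Y)" using Y R e0 unfolding P_def VS by (auto simp: Un_assoc)
    moreover have "R - (R - Y) = Y" using Y(1) by blast
    then have "Q n R (R - Y)" using Y(2,3) unfolding Q_def e e0 by auto
    ultimately show ?thesis by blast
  qed
  have "\<exists>R. R 0 = B\<^sub>1 \<and> (\<forall>n. P n (R n) \<and> Q n (R n) (R (Suc n)))"
  proof -
    define R where "R = rec_nat B\<^sub>1 (\<lambda>n R. SOME R'. P (Suc n) R' \<and> Q n R R')"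
    have R0: "R 0 = B\<^sub>1" by (simp add: R_def)
    have RS: "R (Suc n) = (SOME R'. P (Suc n) R' \<and> Q n (R n) R')" for n by (simp add: R_def)
    have P0: "P 0 B\<^sub>1" using B1 cl01 by (simp add: P_def V0)
    have nxt: "P (Suc n) (R (Suc n)) \<and> Q n (R n) (R (Suc n))" if "P n (R n)" for n
      unfolding RS by (rule someI_ex) (rule step[OF that])
    have "P n (R n)" for n by (induction n) (use P0 R0 nxt in auto)
    then show ?thesis using R0 nxt by blast
  qed
  then obtain R where R: "R 0 = B\<^sub>1" "\<And>n. P n (R n)" "\<And>n. Q n (R n) (R (Suc n))" by blast
  define Y where "Y n = R n - R (Suc n)" for n
  have dec: "R n \<subseteq> R m" if "m \<le> n" for m n
    using lift_Suc_antimono_le[of R, OF _ that] R(3) by (simp add: Q_def)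
  have "disjoint_family Y"
  proof -
    have "Y m \<inter> Y n = {}" if "m < n" for m n
      using dec[of "Suc m" n] that by (auto simp: Y_def)
    then show ?thesis unfolding disjoint_family_on_def by (metis Int_commute nat_neq_iff)
  qed
  moreover have "(\<Union>n. Y n) = B\<^sub>1"
  proof
    show "(\<Union>n. Y n) \<subseteq> B\<^sub>1" using R(2) by (auto simp: Y_def P_def)
    show "B\<^sub>1 \<subseteq> (\<Union>n. Y n)"
    proof
      fix b assume b: "b \<in> B\<^sub>1"
      show "b \<in> (\<Union>n. Y n)"
      proof (rule ccontr)
        assume "b \<notin> (\<Union>n. Y n)"
        then have all: "b \<in> R n" for n
          by (induction n) (use b R(1) in \<open>auto simp: Y_def\<close>)
        \<comment> \<open>An element that is never removed is spanned over \<open>Z\<close> by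
          finitely many parts, hence by some \<open>V n\<close>, contradicting the independence of
          \<open>R n\<close>.\<close>
        have "{b} \<subseteq> cl (Z \<union> B\<^sub>0)" using b cl01 subset_cl[of "Z \<union> B\<^sub>1"] by auto
        then obtain S where S: "finite S" "S \<subseteq> B\<^sub>0" "{b} \<subseteq> cl (Z \<union> S)"
          using finite_subset_spanning[of "{b}" Z B\<^sub>0] by auto
        have "\<exists>n. S \<subseteq> V n" using S(1,2)
        proof (induction S rule: finite_induct)
          case (insert s S)
          then obtain n m where "S \<subseteq> V n" "s \<in> X m" using un by blast
          \<comment> \<open>\<open>V n\<close> stops before index \<open>n\<close>, so
            \<open>Suc m\<close> is needed to include \<open>X m\<close>.\<close>
          moreover have "V n \<subseteq> V (max n (Suc m))" "X m \<subseteq> V (max n (Suc m))"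
            unfolding V_def by (intro UN_mono, simp_all) (intro UN_upper, simp)
          ultimately have "insert s S \<subseteq> V (max n (Suc m))" by blast
          then show ?case by blast
        qed simp
        then obtain n where "S \<subseteq> V n" by blast
        then have "b \<in> cl (Z \<union> V n)" using S(3) cl_monoD[of b "Z \<union> S" "Z \<union> V n"] by blast
        moreover have "indep (Z \<union> V n) (R n)" using R(2) by (simp add: P_def)
        ultimately show False using all[of n] indep_notin_cl by blast
      qed
    qed
  qed
  moreover have "indep (Z \<union> (B\<^sub>0 - X n)) (Y n)"
    "cl (Z \<union> (B\<^sub>0 - X n) \<union> Y n) = cl (Z \<union> B\<^sub>0)" for n
    using R(3)[of n] by (simp_all add: Q_def Y_def)
  ultimately show thesis by (rule that)
qed

text \<open>Transport along an injection into the naturals. Numbers outside its image get an empty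
  part of \<open>B\<^sub>0\<close>; the matching \<open>Y n\<close> is independent over
  \<open>Z \<union> B\<^sub>0\<close> but spanned by it, hence empty.\<close>

lemma countable_exchange:
  fixes X :: "'i \<Rightarrow> 'a set"
  assumes B0: "indep Z B\<^sub>0" and B1: "indep Z B\<^sub>1" and cl01: "cl (Z \<union> B\<^sub>0) = cl (Z \<union> B\<^sub>1)"
    and K: "countable K" and fin: "\<And>k. k \<in> K \<Longrightarrow> finite (X k)"
    and disj: "disjoint_family_on X K" and un: "(\<Union>k\<in>K. X k) = B\<^sub>0"
  obtains Y where "disjoint_family_on Y K" "(\<Union>k\<in>K. Y k) = B\<^sub>1"
    "\<And>k. k \<in> K \<Longrightarrow> indep (Z \<union> (B\<^sub>0 - X k)) (Y k)"
    "\<And>k. k \<in> K \<Longrightarrow> cl (Z \<union> (B\<^sub>0 - X k) \<union> Y k) = cl (Z \<union> B\<^sub>0)"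
proof -
  obtain f :: "'i \<Rightarrow> nat" where f: "inj_on f K" using K countable_def by blast
  define X' where "X' n = (\<Union>k\<in>{k\<in>K. f k = n}. X k)" for n
  have X'f: "X' (f k) = X k" if "k \<in> K" for k
  proof -
    have "{k'\<in>K. f k' = f k} = {k}" using that f by (auto dest: inj_onD)
    then show ?thesis by (simp add: X'_def)
  qed
  have X'0: "X' n = {}" if "n \<notin> f ` K" for n using that by (auto simp: X'_def)
  have finX': "finite (X' n)" for n using X'f X'0 fin by (metis finite.emptyI imageE)
  have disjX': "disjoint_family X'"
    unfolding disjoint_family_on_def
  proof (intro ballI impI)
    fix m n :: nat assume "m \<noteq> n"
    then have "X k \<inter> X l = {}" if "k \<in> K" "f k = m" "l \<in> K" "f l = n" for k l
      using that disj unfolding disjoint_family_on_def by metis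
    then show "X' m \<inter> X' n = {}" unfolding X'_def by blast
  qed
  have unX': "(\<Union>n. X' n) = B\<^sub>0" using un by (auto simp: X'_def)
  obtain Y where Y: "disjoint_family Y" "(\<Union>n. Y n) = B\<^sub>1"
    "\<And>n. indep (Z \<union> (B\<^sub>0 - X' n)) (Y n)" "\<And>n. cl (Z \<union> (B\<^sub>0 - X' n) \<union> Y n) = cl (Z \<union> B\<^sub>0)"
    by (rule sequential_exchange[OF B0 B1 cl01 finX' disjX' unX']) (rule that; assumption)
  have Y0: "Y n = {}" if "n \<notin> f ` K" for n
  proof -
    have "Y n \<subseteq> cl (Z \<union> B\<^sub>0)" using Y(2) cl01 subset_cl[of "Z \<union> B\<^sub>1"] by blast
    moreover have "indep (Z \<union> B\<^sub>0) (Y n)" using Y(3)[of n] X'0[OF that] by simp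
    ultimately show ?thesis using indep_notin_cl by blast
  qed
  show thesis
  proof (rule that[of "\<lambda>k. Y (f k)"])
    show "disjoint_family_on (\<lambda>k. Y (f k)) K"
      using Y(1) f unfolding disjoint_family_on_def inj_on_def by blast
    have "(\<Union>n. Y n) \<subseteq> (\<Union>n\<in>f ` K. Y n)"
    proof (rule UN_least)
      show "Y n \<subseteq> (\<Union>n\<in>f ` K. Y n)" for n by (cases "n \<in> f ` K") (auto simp: Y0)
    qed
    then show "(\<Union>k\<in>K. Y (f k)) = B\<^sub>1" using Y(2) by auto
    show "indep (Z \<union> (B\<^sub>0 - X k)) (Y (f k))" if "k \<in> K" for k
      using Y(3)[of "f k"] X'f that by simp
    show "cl (Z \<union> (B\<^sub>0 - X k) \<union> Y (f k)) = cl (Z \<union> B\<^sub>0)" if "k \<in> K" for k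
      using Y(4)[of "f k"] X'f that by simp
  qed
qed

text \<open>The sets \<open>N i\<close> of new indices, taken along \<open>r\<close>, partition the
  index set. Each is handled by \<open>countable_exchange\<close> over the parts contracted before,
  and the resulting families are glued.\<close>

lemma partition_exchange:
  fixes X :: "'i \<Rightarrow> 'a set" and r :: "'i rel"
  assumes B0: "indep {} B\<^sub>0" and B1: "indep {} B\<^sub>1" and cl01: "cl B\<^sub>0 = cl B\<^sub>1"
    and wo: "Well_order r"
    and fin: "\<And>k. k \<in> Field r \<Longrightarrow> finite (X k)"
    and disj: "disjoint_family_on X (Field r)" and un: "(\<Union>k\<in>Field r. X k) = B\<^sub>0"
  obtains Y where "disjoint_family_on Y (Field r)" "(\<Union>k\<in>Field r. Y k) = B\<^sub>1"
    "\<And>k. k \<in> Field r \<Longrightarrow> indep {} ((B\<^sub>0 - X k) \<union> Y k)"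
    "\<And>k. k \<in> Field r \<Longrightarrow> cl ((B\<^sub>0 - X k) \<union> Y k) = cl B\<^sub>0"
proof -
  let ?K = "Field r"
  \<comment> \<open>Finite witnesses are chosen in both directions: \<open>D k\<close> inside
    \<open>B\<^sub>1\<close> spans \<open>X k\<close>, and below the parts indexed by
    \<open>F b\<close> span \<open>b\<close>.\<close>
  have "\<forall>k\<in>?K. \<exists>S. finite S \<and> S \<subseteq> B\<^sub>1 \<and> X k \<subseteq> cl S"
  proof
    fix k assume k: "k \<in> ?K"
    then have "X k \<subseteq> cl ({} \<union> B\<^sub>1)" using un subset_cl[of B\<^sub>0] cl01 by auto
    then show "\<exists>S. finite S \<and> S \<subseteq> B\<^sub>1 \<and> X k \<subseteq> cl S"
      by (rule finite_subset_spanning[OF fin[OF k]]) auto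
  qed
  then obtain D where "\<forall>k\<in>?K. finite (D k) \<and> D k \<subseteq> B\<^sub>1 \<and> X k \<subseteq> cl (D k)"
    by (rule bchoice[THEN exE])
  then have D: "finite (D k)" "D k \<subseteq> B\<^sub>1" "X k \<subseteq> cl (D k)" if "k \<in> ?K" for k
    using that by auto
  have "\<forall>b\<in>B\<^sub>1. \<exists>F. finite F \<and> F \<subseteq> ?K \<and> b \<in> cl (\<Union>k\<in>F. X k)"
  proof
    fix b assume "b \<in> B\<^sub>1"
    then have "b \<in> cl B\<^sub>0" using subset_cl[of B\<^sub>1] cl01 by auto
    then obtain S where S: "finite S" "S \<subseteq> B\<^sub>0" "b \<in> cl S" using cl_finitary by metis
    then obtain F where F: "finite F" "F \<subseteq> ?K" "S \<subseteq> (\<Union>k\<in>F. X k)"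
      using finite_subset_Union[of S "X ` ?K"] un finite_subset_image by metis
    then show "\<exists>F. finite F \<and> F \<subseteq> ?K \<and> b \<in> cl (\<Union>k\<in>F. X k)"
      using cl_monoD[OF S(3) F(3)] by auto
  qed
  then obtain F where "\<forall>b\<in>B\<^sub>1. finite (F b) \<and> F b \<subseteq> ?K \<and> b \<in> cl (\<Union>k\<in>F b. X k)"
    by (rule bchoice[THEN exE])
  then have F: "finite (F b)" "F b \<subseteq> ?K" "b \<in> cl (\<Union>k\<in>F b. X k)" if "b \<in> B\<^sub>1" for b
    using that by auto
  \<comment> \<open>Parts indexed by \<open>J\<close> are spanned by elements of
    \<open>B\<^sub>1\<close> that are in turn spanned by such parts. The condition concerns single
    indices, so it passes to arbitrary unions.\<close>
  define closed where "closed J \<longleftrightarrow> J \<subseteq> ?K \<and> (\<forall>k\<in>J. \<forall>b\<in>D k. F b \<subseteq> J)" for J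
  define XX where "XX J = (\<Union>k\<in>J. X k)" for J
  define DD where "DD J = (\<Union>k\<in>J. D k)" for J
  have XK: "XX ?K = B\<^sub>0" using un by (simp add: XX_def)
  have XX_B0: "XX J \<subseteq> B\<^sub>0" if "J \<subseteq> ?K" for J using that un by (auto simp: XX_def)
  have DD_B1: "DD J \<subseteq> B\<^sub>1" if "J \<subseteq> ?K" for J using that D(2) by (auto simp: DD_def)
  have XX_disj: "XX I \<inter> XX J = {}" if "I \<subseteq> ?K" "J \<subseteq> ?K" "I \<inter> J = {}" for I J
  proof -
    have "X i \<inter> X j = {}" if "i \<in> I" "j \<in> J" for i j
      by (rule disjoint_family_onD[OF disj]) (use \<open>I \<subseteq> ?K\<close> \<open>J \<subseteq> ?K\<close> \<open>I \<inter> J = {}\<close> that in auto)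
    then show ?thesis unfolding XX_def by blast
  qed
  have cl_closed: "cl (XX J) = cl (DD J)" if J: "closed J" for J
  proof (rule cl_eqI)
    have JK: "J \<subseteq> ?K" using J by (simp add: closed_def)
    show "XX J \<subseteq> cl (DD J)"
      unfolding XX_def
    proof (rule UN_least)
      fix k assume k: "k \<in> J"
      then have "D k \<subseteq> DD J" by (auto simp: DD_def)
      moreover have "X k \<subseteq> cl (D k)" using D(3) k JK by blast
      ultimately show "X k \<subseteq> cl (DD J)" by (rule subset_cl_trans[rotated])
    qed
    show "DD J \<subseteq> cl (XX J)"
    proof
      fix b assume "b \<in> DD J"
      then obtain k where k: "k \<in> J" "b \<in> D k" by (auto simp: DD_def)
      then have "F b \<subseteq> J" using J by (simp add: closed_def)
      then have "(\<Union>k\<in>F b. X k) \<subseteq> XX J" by (auto simp: XX_def)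
      moreover have "b \<in> B\<^sub>1" using k JK D(2) by auto
      ultimately show "b \<in> cl (XX J)" using F(3) cl_monoD by metis
    qed
  qed
  \<comment> \<open>\<open>C i\<close> is the least closed set containing \<open>i\<close>; it is countable because \<open>G\<close> is finitely branching\<close>
  define G where "G = {(k, j). k \<in> ?K \<and> (\<exists>b\<in>D k. j \<in> F b)}"
  define C where "C i = G\<^sup>* `` {i}" for i
  have C_refl: "i \<in> C i" for i by (simp add: C_def)
  have CK: "C i \<subseteq> ?K" if "i \<in> ?K" for i
  proof -
    have "j \<in> ?K" if "(i, j) \<in> G\<^sup>*" for j
      using that
    proof (induction rule: rtrancl_induct)
      case base
      then show ?case by (rule \<open>i \<in> ?K\<close>)
    next
      case (step j k)
      then obtain b where "b \<in> D j" "k \<in> F b" by (auto simp: G_def)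
      moreover from this have "b \<in> B\<^sub>1" using D(2)[OF step.IH] by blast
      ultimately show ?case using F(2) by blast
    qed
    then show ?thesis by (auto simp: C_def)
  qed
  have C_closed: "closed (C i)" if "i \<in> ?K" for i
    unfolding closed_def
  proof (intro conjI ballI subsetI)
    fix k b j assume "k \<in> C i" "b \<in> D k" "j \<in> F b"
    then have "(i, k) \<in> G\<^sup>*" "(k, j) \<in> G" using CK[OF that] by (auto simp: C_def G_def)
    then show "j \<in> C i" by (auto simp: C_def)
  qed (use CK that in auto)
  have C_countable: "countable (C i)" for i
    unfolding C_def
  proof (rule countable_rtrancl)
    fix J :: "'i set" assume J: "countable J"
    have "G `` J \<subseteq> (\<Union>k\<in>J \<inter> ?K. \<Union>b\<in>D k. F b)" by (auto simp: G_def)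
    moreover have "finite (\<Union>b\<in>D k. F b)" if "k \<in> J \<inter> ?K" for k
      using that D(1,2)[of k] F(1) by auto
    then have "countable (\<Union>k\<in>J \<inter> ?K. \<Union>b\<in>D k. F b)"
      by (intro countable_UN[OF countable_Int1[OF J]] countable_finite)
    ultimately show "countable (G `` J)" by (rule countable_subset)
  qed simp
  \<comment> \<open>\<open>U i\<close> is what has been reached before \<open>i\<close>, closed as a
    union of closed sets; \<open>N i\<close> holds the indices first reached at \<open>i\<close> and
    may be empty.\<close>
  define U where "U i = (\<Union>j\<in>underS r i. C j)" for i
  define N where "N i = C i - U i" for i
  have SK: "underS r i \<subseteq> ?K" for i by (auto simp: underS_def Field_def)
  have UK: "U i \<subseteq> ?K" for i using CK SK by (auto simp: U_def)
  have closed_UN: "closed (\<Union>j\<in>J. C j)" if "J \<subseteq> ?K" for J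
    using C_closed that unfolding closed_def by blast
  have U_closed: "closed (U i)" for i unfolding U_def by (rule closed_UN[OF SK])
  have UC_closed: "closed (U i \<union> C i)" if "i \<in> ?K" for i
    using U_closed C_closed[OF that] unfolding closed_def by blast
  have lin: "i \<in> underS r j \<or> j \<in> underS r i" if "i \<in> ?K" "j \<in> ?K" "i \<noteq> j" for i j
    using wo that by (auto simp: underS_def well_order_on_def linear_order_on_def total_on_def)
  have U_step: "U i \<union> C i \<subseteq> U j" if "i \<in> underS r j" for i j
  proof -
    have "trans r" "antisym r"
      using wo by (auto simp: well_order_on_def linear_order_on_def partial_order_on_def preorder_on_def)
    then have "underS r i \<subseteq> underS r j"
      using that unfolding underS_def by (auto dest: transD antisymD)
    then show ?thesis using that unfolding U_def by blast
  qed
  have least: "\<exists>i\<in>?K. P i \<and> (\<forall>j\<in>underS r i. \<not> P j)" if "k \<in> ?K" "P k" for P k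
  proof -
    have wf: "wf (r - Id)" using wo by (simp add: well_order_on_def)
    have k: "k \<in> {i \<in> ?K. P i}" using that by simp
    obtain i where "i \<in> {i \<in> ?K. P i}" "\<And>j. (j, i) \<in> r - Id \<Longrightarrow> j \<notin> {i \<in> ?K. P i}"
      by (rule wfE_min[OF wf k]) (rule that; assumption)
    then show ?thesis using SK[of i] by (auto simp: underS_def)
  qed
  \<comment> \<open>\<open>XX (N i)\<close> and the new elements of \<open>B\<^sub>1\<close> are
    independent over \<open>XX (U i)\<close> with equal closure there, because \<open>U i\<close>
    and \<open>U i \<union> C i\<close> are closed.\<close>
  have local: "\<exists>Y. disjoint_family_on Y (N i) \<and> (\<Union>k\<in>N i. Y k) = DD (U i \<union> C i) - DD (U i) \<and>
    (\<forall>k\<in>N i. indep {} ((B\<^sub>0 - X k) \<union> Y k) \<and> cl ((B\<^sub>0 - X k) \<union> Y k) = cl B\<^sub>0)" if i: "i \<in> ?K" for i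
  proof -
    let ?Z = "XX (U i)" and ?V = "U i \<union> C i"
    have NK: "N i \<subseteq> ?K" and VK: "?V \<subseteq> ?K" using CK[OF i] UK by (auto simp: N_def)
    have ZN: "?Z \<union> XX (N i) = XX ?V" by (auto simp: XX_def N_def)
    have ZN0: "?Z \<inter> XX (N i) = {}" using XX_disj[OF UK NK] by (auto simp: N_def)
    have iN: "indep ?Z (XX (N i))"
      using indep_contract[of "{}" ?Z "XX (N i)"] indep_subset[OF B0 XX_B0[OF VK]] ZN ZN0 by simp
    have DV: "DD (U i) \<subseteq> DD ?V" by (auto simp: DD_def)
    have "indep (DD (U i)) (DD ?V - DD (U i))"
      using indep_contract_Diff[OF indep_subset[OF B1 DD_B1[OF VK]] DV] by simp
    then have iD: "indep ?Z (DD ?V - DD (U i))"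
      by (rule indep_mono) (use subset_cl[of ?Z] cl_closed[OF U_closed[of i]] in auto)
    have "cl (?Z \<union> (DD ?V - DD (U i))) = cl (DD ?V)"
    proof (rule cl_eqI)
      have "?Z \<subseteq> cl (DD (U i))" using subset_cl[of ?Z] cl_closed[OF U_closed[of i]] by simp
      then show "?Z \<union> (DD ?V - DD (U i)) \<subseteq> cl (DD ?V)"
        using subset_cl_trans[OF _ DV] subset_cl[of "DD ?V"] by blast
      have "DD (U i) \<subseteq> cl ?Z" using subset_cl[of "DD (U i)"] cl_closed[OF U_closed[of i]] by simp
      then have "DD (U i) \<subseteq> cl (?Z \<union> (DD ?V - DD (U i)))" by (rule subset_cl_trans) simp
      then show "DD ?V \<subseteq> cl (?Z \<union> (DD ?V - DD (U i)))"
        using subset_cl[of "?Z \<union> (DD ?V - DD (U i))"] by blast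
    qed
    then have c: "cl (?Z \<union> XX (N i)) = cl (?Z \<union> (DD ?V - DD (U i)))"
      using ZN cl_closed[OF UC_closed[OF i]] by simp
    have cN: "countable (N i)" using C_countable[of i] by (simp add: N_def)
    have fN: "finite (X k)" if "k \<in> N i" for k using that NK fin by auto
    have dN: "disjoint_family_on X (N i)" using disj NK by (rule disjoint_family_on_mono[rotated])
    obtain Y where Y: "disjoint_family_on Y (N i)" "(\<Union>k\<in>N i. Y k) = DD ?V - DD (U i)"
      "\<And>k. k \<in> N i \<Longrightarrow> indep (?Z \<union> (XX (N i) - X k)) (Y k)"
      "\<And>k. k \<in> N i \<Longrightarrow> cl (?Z \<union> (XX (N i) - X k) \<union> Y k) = cl (?Z \<union> XX (N i))"
      by (rule countable_exchange[OF iN iD c cN fN dN XX_def[symmetric]]) (assumption, (rule that; assumption))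
    have "indep {} ((B\<^sub>0 - X k) \<union> Y k) \<and> cl ((B\<^sub>0 - X k) \<union> Y k) = cl B\<^sub>0" if k: "k \<in> N i" for k
    proof -
      let ?A = "XX ?V - X k" and ?R = "B\<^sub>0 - XX ?V"
      have Xk: "X k \<subseteq> XX (N i)" using k by (auto simp: XX_def)
      have e: "?Z \<union> (XX (N i) - X k) = ?A" using ZN ZN0 Xk by blast
      have VB: "XX ?V \<subseteq> B\<^sub>0" by (rule XX_B0[OF VK])
      have cA: "cl (?A \<union> Y k) = cl (XX ?V)" using Y(4)[OF k] ZN e by simp
      have "indep {} ?A" by (rule indep_subset[OF B0]) (use VB in auto)
      moreover have "indep ({} \<union> ?A) (Y k)" using Y(3)[OF k] e by simp
      ultimately have "indep {} (?A \<union> Y k)" by (rule indep_Un)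
      \<comment> \<open>\<open>?A \<union> Y k\<close> has the same closure as \<open>XX ?V\<close>,
        so the untouched rest \<open>?R\<close> of \<open>B\<^sub>0\<close> stays independent over
        it.\<close>
      moreover have "indep (XX ?V) ?R" using indep_contract_Diff[OF B0 VB] by simp
      then have "indep ({} \<union> (?A \<union> Y k)) ?R"
        by (rule indep_mono) (use cA subset_cl[of "?A \<union> Y k"] in auto)
      ultimately have "indep {} ((?A \<union> Y k) \<union> ?R)" by (rule indep_Un)
      moreover have "(?A \<union> Y k) \<union> ?R = (B\<^sub>0 - X k) \<union> Y k" using VB Xk ZN by blast
      moreover have "cl ((B\<^sub>0 - X k) \<union> Y k) = cl B\<^sub>0"
      proof (rule cl_eqI)
        have "Y k \<subseteq> B\<^sub>1" using Y(2) k DD_B1[OF VK] by blast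
        then show "(B\<^sub>0 - X k) \<union> Y k \<subseteq> cl B\<^sub>0"
          using subset_cl[of B\<^sub>0] subset_cl[of B\<^sub>1] cl01 by blast
        have "XX ?V \<subseteq> cl (?A \<union> Y k)" using cA subset_cl[of "XX ?V"] by simp
        then have "XX ?V \<subseteq> cl ((B\<^sub>0 - X k) \<union> Y k)"
          by (rule subset_cl_trans) (use VB in auto)
        then show "B\<^sub>0 \<subseteq> cl ((B\<^sub>0 - X k) \<union> Y k)"
          using subset_cl[of "(B\<^sub>0 - X k) \<union> Y k"] Xk ZN by blast
      qed
      ultimately show ?thesis by simp
    qed
    then show ?thesis using Y(1,2) by (intro exI[of _ Y]) simp
  qed
  then have "\<forall>i\<in>?K. \<exists>Y. disjoint_family_on Y (N i) \<and>
    (\<Union>k\<in>N i. Y k) = DD (U i \<union> C i) - DD (U i) \<and>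
    (\<forall>k\<in>N i. indep {} ((B\<^sub>0 - X k) \<union> Y k) \<and> cl ((B\<^sub>0 - X k) \<union> Y k) = cl B\<^sub>0)"
    by (rule ballI)
  then obtain Yf where "\<forall>i\<in>?K. disjoint_family_on (Yf i) (N i) \<and>
    (\<Union>k\<in>N i. Yf i k) = DD (U i \<union> C i) - DD (U i) \<and>
    (\<forall>k\<in>N i. indep {} ((B\<^sub>0 - X k) \<union> Yf i k) \<and> cl ((B\<^sub>0 - X k) \<union> Yf i k) = cl B\<^sub>0)"
    by (rule bchoice[THEN exE])
  then have Yf: "disjoint_family_on (Yf i) (N i)"
    "(\<Union>k\<in>N i. Yf i k) = DD (U i \<union> C i) - DD (U i)"
    "\<And>k. k \<in> N i \<Longrightarrow> indep {} ((B\<^sub>0 - X k) \<union> Yf i k) \<and> cl ((B\<^sub>0 - X k) \<union> Yf i k) = cl B\<^sub>0"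
    if "i \<in> ?K" for i using that by auto
  \<comment> \<open>An index \<open>k\<close> is new at the least \<open>i\<close> with
    \<open>k \<in> C i\<close>.\<close>
  have "\<forall>k\<in>?K. \<exists>i. i \<in> ?K \<and> k \<in> N i"
  proof
    fix k assume "k \<in> ?K"
    then show "\<exists>i. i \<in> ?K \<and> k \<in> N i"
      using least[of k "\<lambda>i. k \<in> C i"] C_refl by (auto simp: N_def U_def)
  qed
  then obtain ix where "\<forall>k\<in>?K. ix k \<in> ?K \<and> k \<in> N (ix k)" by (rule bchoice[THEN exE])
  then have ix: "ix k \<in> ?K" "k \<in> N (ix k)" if "k \<in> ?K" for k using that by auto
  have ix_eq: "ix k = i" if "i \<in> ?K" "k \<in> N i" for i k
  proof (rule ccontr)
    have k: "k \<in> ?K" using that CK by (auto simp: N_def)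
    assume "ix k \<noteq> i"
    then have "ix k \<in> underS r i \<or> i \<in> underS r (ix k)" using lin[OF ix(1)[OF k] that(1)] by blast
    then show False
    proof
      assume "ix k \<in> underS r i"
      then show False using U_step[of "ix k" i] ix(2)[OF k] that(2) by (auto simp: N_def)
    next
      assume "i \<in> underS r (ix k)"
      then show False using U_step[of i "ix k"] ix(2)[OF k] that(2) by (auto simp: N_def)
    qed
  qed
  have DD_Yf: "Yf i k \<subseteq> DD (U i \<union> C i) - DD (U i)" if "i \<in> ?K" "k \<in> N i" for i k
    using Yf(2)[OF that(1)] that(2) by blast
  have disj_lt: "Yf i k \<inter> Yf j l = {}"
    if "i \<in> underS r j" "i \<in> ?K" "j \<in> ?K" "k \<in> N i" "l \<in> N j" for i j k l
  proof -
    \<comment> \<open>What is used at the earlier \<open>i\<close> lies in \<open>DD (U j)\<close>,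
      which is removed at \<open>j\<close>.\<close>
    have "DD (U i \<union> C i) \<subseteq> DD (U j)" using U_step[OF that(1)] unfolding DD_def by blast
    then show ?thesis using DD_Yf[OF that(2,4)] DD_Yf[OF that(3,5)] by blast
  qed
  show thesis
  proof (rule that[of "\<lambda>k. Yf (ix k) k"])
    show "disjoint_family_on (\<lambda>k. Yf (ix k) k) ?K"
      unfolding disjoint_family_on_def
    proof (intro ballI impI)
      fix k l assume kl: "k \<in> ?K" "l \<in> ?K" "k \<noteq> l"
      show "Yf (ix k) k \<inter> Yf (ix l) l = {}"
      proof (cases "ix k = ix l")
        case True
        then show ?thesis
          using Yf(1)[OF ix(1)[OF kl(1)]] ix(2) kl unfolding disjoint_family_on_def by metis
      next
        case False
        then have "ix k \<in> underS r (ix l) \<or> ix l \<in> underS r (ix k)"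
          using lin[OF ix(1)[OF kl(1)] ix(1)[OF kl(2)]] by blast
        then show ?thesis
          using disj_lt[of "ix k" "ix l" k l] disj_lt[of "ix l" "ix k" l k] ix[OF kl(1)] ix[OF kl(2)]
          by (auto simp: Int_commute)
      qed
    qed
    show "(\<Union>k\<in>?K. Yf (ix k) k) = B\<^sub>1"
    proof
      show "(\<Union>k\<in>?K. Yf (ix k) k) \<subseteq> B\<^sub>1"
      proof (rule UN_least)
        fix k assume k: "k \<in> ?K"
        have "U (ix k) \<union> C (ix k) \<subseteq> ?K" using CK[OF ix(1)[OF k]] UK[of "ix k"] by blast
        then show "Yf (ix k) k \<subseteq> B\<^sub>1" using DD_Yf[OF ix[OF k]] DD_B1 by blast
      qed
      show "B\<^sub>1 \<subseteq> (\<Union>k\<in>?K. Yf (ix k) k)"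
      proof
        fix b assume b: "b \<in> B\<^sub>1"
        \<comment> \<open>Since the full index set is closed, \<open>DD ?K\<close> spans
          \<open>B\<^sub>1\<close>; as a spanning subset of an independent set it contains
          \<open>b\<close>.\<close>
        have "closed ?K" using D(2) F(2) unfolding closed_def by blast
        then have clK: "cl (DD ?K) = cl B\<^sub>1" using cl_closed[of ?K] XK cl01 by simp
        have "b \<in> DD ?K"
        proof (rule ccontr)
          assume "b \<notin> DD ?K"
          then have "DD ?K \<subseteq> {} \<union> (B\<^sub>1 - {b})" using DD_B1[of ?K] by blast
          moreover have "b \<in> cl (DD ?K)" using clK in_cl[OF b] by simp
          ultimately have "b \<in> cl ({} \<union> (B\<^sub>1 - {b}))" by (metis cl_monoD)
          then show False using B1 b unfolding indep_def by blast
        qed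
        then obtain k where k: "k \<in> ?K" "b \<in> D k" by (auto simp: DD_def)
        then obtain i where i: "i \<in> ?K" "b \<in> DD (C i)" "\<forall>j\<in>underS r i. b \<notin> DD (C j)"
          using least[of k "\<lambda>i. b \<in> DD (C i)"] C_refl[of k] unfolding DD_def by blast
        then have "b \<in> DD (U i \<union> C i) - DD (U i)" unfolding DD_def U_def by blast
        then obtain l where l: "l \<in> N i" "b \<in> Yf i l" using Yf(2)[OF i(1)] by blast
        then have "l \<in> ?K" "ix l = i" using ix_eq i(1) CK by (auto simp: N_def)
        then show "b \<in> (\<Union>k\<in>?K. Yf (ix k) k)" using l by blast
      qed
    qed
    show "indep {} ((B\<^sub>0 - X k) \<union> Yf (ix k) k)" "cl ((B\<^sub>0 - X k) \<union> Yf (ix k) k) = cl B\<^sub>0"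
      if "k \<in> ?K" for k
      using Yf(3)[OF ix[OF that]] by auto
  qed
qed

end

section \<open>The pregeometry of a finitary matroid\<close>

context finitary_matroid
begin

section \<open>Augmentation of finite independent sets\<close>

lemma augment_finite:
  assumes "I \<in> \<I>" "J \<in> \<I>" "finite I" "finite J" "card I < card J"
  obtains e where "e \<in> J - I" "insert e I \<in> \<I>"
proof -
  have "\<nexists>f. inj_on f J \<and> f ` J \<subseteq> I"
    using assms(3,5) by (meson card_inj_on_le not_le)
  then have "|I| <o |J|" by (simp only: card_of_ordLess)
  then show thesis using augmentation[OF assms(1,2)] that by auto
qed

text \<open>Iterated augmentation. The truncated difference in the induction is \<open>0\<close>
  when \<open>I\<close> is already large enough, and then \<open>I\<close> itself serves.\<close>

lemma augment_to_card:
  assumes "I \<in> \<I>" "J \<in> \<I>" "finite I" "finite J"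
  obtains I' where "I' \<in> \<I>" "I \<subseteq> I'" "I' \<subseteq> I \<union> J" "card J \<le> card I'"
proof -
  have "\<exists>I'. I' \<in> \<I> \<and> I \<subseteq> I' \<and> I' \<subseteq> I \<union> J \<and> card J \<le> card I'"
    using assms(1,3)
  proof (induction "card J - card I" arbitrary: I)
    case 0
    then show ?case by (intro exI[of _ I]) auto
  next
    case (Suc n)
    then have "card I < card J" by simp
    then obtain e where e: "e \<in> J - I" "insert e I \<in> \<I>"
      using augment_finite Suc.prems assms(2,4) by metis
    have "n = card J - card (insert e I)" using Suc.hyps(2) Suc.prems(2) e(1) by simp
    then obtain I' where "I' \<in> \<I>" "insert e I \<subseteq> I'" "I' \<subseteq> insert e I \<union> J" "card J \<le> card I'"
      using Suc.hyps(1)[of "insert e I"] e(2) Suc.prems(2) by auto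
    then show ?case using e(1) by (intro exI[of _ I']) auto
  qed
  then show thesis using that by blast
qed

text \<open>Elements of \<open>A\<close> need their own clause, since inserting them into a set that
  contains them changes nothing. Anything outside \<open>E\<close> lies in every span, with
  \<open>F\<close> empty, so bases span \<open>UNIV\<close>.\<close>

definition span :: "'a set \<Rightarrow> 'a set" where
  "span A = {e. e \<in> A \<or> (\<exists>F\<subseteq>A. finite F \<and> F \<in> \<I> \<and> insert e F \<notin> \<I>)}"

lemma span_mono: "A \<subseteq> B \<Longrightarrow> span A \<subseteq> span B"
  unfolding span_def by blast

text \<open>Were \<open>insert e H\<close> independent, augmenting \<open>F\<close> from it would
  give an independent set larger than \<open>H\<close> that avoids \<open>e\<close>. Some element of
  it extends \<open>H\<close>; this element lies in \<open>F\<close>, contrary to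
  \<open>dep\<close>.\<close>

lemma dependent_trans:
  assumes H: "finite H" "H \<in> \<I>" and F: "finite F" "F \<in> \<I>"
    and dep: "\<And>f. f \<in> F \<Longrightarrow> f \<in> H \<or> insert f H \<notin> \<I>" and e: "insert e F \<notin> \<I>"
  shows "e \<in> H \<or> insert e H \<notin> \<I>"
proof (rule ccontr)
  assume "\<not> ?thesis"
  then have n: "e \<notin> H" "insert e H \<in> \<I>" by auto
  obtain F' where F': "F' \<in> \<I>" "F \<subseteq> F'" "F' \<subseteq> F \<union> insert e H" "card (insert e H) \<le> card F'"
    using augment_to_card[OF F(2) n(2) F(1)] H(1) by auto
  have fin: "finite F'" using F'(3) F(1) H(1) finite_subset by auto
  have "e \<notin> F'" using F'(1,2) e downward_closed[of F' "insert e F"] by auto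
  have "card H < card F'" using F'(4) n(1) H(1) by simp
  then obtain f where f: "f \<in> F' - H" "insert f H \<in> \<I>"
    using augment_finite[OF H(2) F'(1) H(1) fin] by blast
  then have "f \<in> F" using F'(3) \<open>e \<notin> F'\<close> by auto
  then show False using dep f by auto
qed

lemma maximal_indep_subset:
  assumes "finite G"
  obtains H where "H \<subseteq> G" "H \<in> \<I>" "\<And>g. g \<in> G \<Longrightarrow> g \<in> H \<or> insert g H \<notin> \<I>"
proof -
  have "finite {H. H \<subseteq> G \<and> H \<in> \<I>}" using assms by simp
  moreover have "{} \<in> {H. H \<subseteq> G \<and> H \<in> \<I>}" using empty_indep by simp
  ultimately obtain H where "H \<in> {H. H \<subseteq> G \<and> H \<in> \<I>}"
    "\<And>H'. H' \<in> {H. H \<subseteq> G \<and> H \<in> \<I>} \<Longrightarrow> H \<subseteq> H' \<Longrightarrow> H = H'"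
    using finite_has_maximal2 by (metis (no_types, lifting))
  then show thesis using that[of H] by blast
qed

text \<open>The witnesses for the elements of \<open>F\<close> have a finite union inside
  \<open>A\<close>. A maximal independent subset \<open>H\<close> of it is a common witness, by
  \<open>dependent_trans\<close> first for each element of \<open>F\<close> and then for
  \<open>e\<close>.\<close>

lemma span_idem: "span (span A) = span A"
proof
  show "span A \<subseteq> span (span A)" unfolding span_def by blast
  show "span (span A) \<subseteq> span A"
  proof
    fix e assume e: "e \<in> span (span A)"
    show "e \<in> span A"
    proof (rule ccontr)
      assume ne: "e \<notin> span A"
      then obtain F where F: "F \<subseteq> span A" "finite F" "F \<in> \<I>" "insert e F \<notin> \<I>"
        using e unfolding span_def[of "span A"] by blast
      have "\<forall>f\<in>F. \<exists>K. K \<subseteq> A \<and> finite K \<and> (f \<in> K \<or> K \<in> \<I> \<and> insert f K \<notin> \<I>)"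
      proof
        fix f assume "f \<in> F"
        then have "f \<in> A \<or> (\<exists>K\<subseteq>A. finite K \<and> K \<in> \<I> \<and> insert f K \<notin> \<I>)"
          using F(1) unfolding span_def by blast
        then show "\<exists>K. K \<subseteq> A \<and> finite K \<and> (f \<in> K \<or> K \<in> \<I> \<and> insert f K \<notin> \<I>)"
        proof
          assume "f \<in> A"
          then show ?thesis by (intro exI[of _ "{f}"]) simp
        qed blast
      qed
      then obtain K where "\<forall>f\<in>F. K f \<subseteq> A \<and> finite (K f) \<and> (f \<in> K f \<or> K f \<in> \<I> \<and> insert f (K f) \<notin> \<I>)"
        by (rule bchoice[THEN exE])
      then have K: "K f \<subseteq> A" "finite (K f)" "f \<in> K f \<or> K f \<in> \<I> \<and> insert f (K f) \<notin> \<I>"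
        if "f \<in> F" for f using that by auto
      let ?G = "\<Union>f\<in>F. K f"
      have G: "finite ?G" "?G \<subseteq> A" using K F(2) by auto
      obtain H where H: "H \<subseteq> ?G" "H \<in> \<I>" "\<And>g. g \<in> ?G \<Longrightarrow> g \<in> H \<or> insert g H \<notin> \<I>"
        using maximal_indep_subset[OF G(1)] by metis
      have finH: "finite H" using H(1) G(1) finite_subset by blast
      have "f \<in> H \<or> insert f H \<notin> \<I>" if f: "f \<in> F" for f
        using K(3)[OF f]
      proof
        assume "f \<in> K f"
        then show ?thesis using H(3) f by blast
      next
        assume Kf: "K f \<in> \<I> \<and> insert f (K f) \<notin> \<I>"
        show ?thesis
        proof (rule dependent_trans[OF finH H(2) K(2)[OF f]])
          show "g \<in> H \<or> insert g H \<notin> \<I>" if "g \<in> K f" for g using H(3) f that by blast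
        qed (use Kf in auto)
      qed
      then have "e \<in> H \<or> insert e H \<notin> \<I>" using dependent_trans[OF finH H(2) F(2,3) _ F(4)] by blast
      moreover have "H \<subseteq> A" using H(1) G(2) by blast
      ultimately show False using ne finH H(2) unfolding span_def by blast
    qed
  qed
qed

sublocale pregeometry span
proof
  show "A \<subseteq> span A" for A unfolding span_def by blast
  show "span A \<subseteq> span B" if "A \<subseteq> B" for A B using that by (rule span_mono)
  show "span (span A) = span A" for A by (rule span_idem)
  show "\<exists>F. finite F \<and> F \<subseteq> A \<and> x \<in> span F" if x: "x \<in> span A" for x A
  proof (cases "x \<in> A")
    case True
    then show ?thesis by (intro exI[of _ "{x}"]) (simp add: span_def)
  next
    case False
    then show ?thesis using x unfolding span_def by blast
  qed
  show "y \<in> span (insert x A)" if x: "x \<in> span (insert y A)" "x \<notin> span A" for x y A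
  proof (cases "x = y")
    case True
    then show ?thesis by (simp add: span_def)
  next
    case False
    then obtain F where F: "F \<subseteq> insert y A" "finite F" "F \<in> \<I>" "insert x F \<notin> \<I>"
      using x unfolding span_def by blast
    \<comment> \<open>Without \<open>y\<close>, \<open>F\<close> would put \<open>x\<close> into
      \<open>span A\<close>. Trading \<open>y\<close> for \<open>x\<close> in \<open>F\<close> gives
      the witness for \<open>y\<close>.\<close>
    then have y: "y \<in> F" using x(2) unfolding span_def by blast
    have sub: "F - {y} \<subseteq> A" using F(1) by blast
    have "F - {y} \<in> \<I>" using F(3) downward_closed by blast
    then have "insert x (F - {y}) \<in> \<I>" using x(2) F(2) sub unfolding span_def by blast
    moreover have "insert y (insert x (F - {y})) \<notin> \<I>" using F(4) y by (simp add: insert_commute insert_absorb)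
    moreover have "insert x (F - {y}) \<subseteq> insert x A" "finite (insert x (F - {y}))" using sub F(2) by auto
    ultimately show ?thesis unfolding span_def by blast
  qed
qed

text \<open>Finite subsets are handled by induction, and \<open>finitary\<close> lifts this to
  infinite \<open>A\<close>; the inclusion in \<open>E\<close> comes from singletons.\<close>

lemma indep_iff: "indep {} A \<longleftrightarrow> A \<in> \<I>"
proof
  assume A: "indep {} A"
  have fin: "F \<in> \<I>" if "finite F" "F \<subseteq> A" for F
    using that
  proof (induction F rule: finite_induct)
    case empty
    show ?case by (rule empty_indep)
  next
    case (insert f F)
    have "f \<notin> span (A - {f})" using A insert.prems by (simp add: indep_def)
    moreover have "F \<subseteq> A - {f}" using insert by blast
    ultimately show ?case using insert unfolding span_def by blast
  qed
  show "A \<in> \<I>"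
  proof (cases "finite A")
    case False
    have "A \<subseteq> E"
    proof
      fix a assume "a \<in> A"
      then have "{a} \<in> \<I>" using fin by simp
      then show "a \<in> E" using indep_subset_carrier by blast
    qed
    then show ?thesis using finitary False fin by blast
  qed (use fin in simp)
next
  assume A: "A \<in> \<I>"
  show "indep {} A"
    unfolding indep_def
  proof (intro ballI notI)
    fix a assume a: "a \<in> A" "a \<in> span ({} \<union> (A - {a}))"
    then obtain F where "F \<subseteq> A - {a}" "insert a F \<notin> \<I>" unfolding span_def by blast
    moreover from this a(1) have "insert a F \<subseteq> A" by blast
    ultimately show False using downward_closed[OF A] by blast
  qed
qed

text \<open>An element outside the span of a base could be inserted by \<open>indep_insert\<close>;
  conversely, any element added to a spanning set is dependent on it.\<close>

lemma is_base_iff: "is_base \<I> B \<longleftrightarrow> indep {} B \<and> span B = UNIV"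
proof (intro iffI conjI)
  assume B: "is_base \<I> B"
  show i: "indep {} B" using B by (simp add: is_base_def indep_iff)
  have "e \<in> span B" for e
  proof (rule ccontr)
    assume e: "e \<notin> span B"
    then have "insert e B \<in> \<I>" using indep_insert[OF i, of e] indep_iff by simp
    moreover have "e \<notin> B" using e in_cl by blast
    ultimately show False using B unfolding is_base_def by blast
  qed
  then show "span B = UNIV" by blast
next
  assume B: "indep {} B \<and> span B = UNIV"
  show "is_base \<I> B"
    unfolding is_base_def
  proof (intro conjI ballI notI)
    show "B \<in> \<I>" using B indep_iff by simp
    fix J assume J: "J \<in> \<I>" "B \<subset> J"
    then obtain j where j: "j \<in> J" "j \<notin> B" by blast
    have "B \<subseteq> J - {j}" using J(2) j(2) by blast
    then have "j \<in> span (J - {j})" using B span_mono by blast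
    then show False using J(1) j(1) indep_iff unfolding indep_def by auto
  qed
qed

end

theorem theorem1p4:
  fixes E :: "'a set" and \<I> :: "'a set set"
    and \<kappa> :: "'i rel" and X :: "'i \<Rightarrow> 'a set"
  assumes "finitary_matroid E \<I>"
    and "is_base \<I> B\<^sub>0" and "is_base \<I> B\<^sub>1"
    and "Card_order \<kappa>"
    and "indexed_partition (Field \<kappa>) X B\<^sub>0"
    and "\<And>i. i \<in> Field \<kappa> \<Longrightarrow> finite (X i)"
  shows "\<exists>Y. indexed_partition (Field \<kappa>) Y B\<^sub>1 \<and>
    (\<forall>i \<in> Field \<kappa>. is_base \<I> ((B\<^sub>0 - X i) \<union> Y i))"
proof -
  interpret finitary_matroid E \<I> by (rule assms(1))
  have B: "indep {} B\<^sub>0" "indep {} B\<^sub>1" "span B\<^sub>0 = UNIV" "span B\<^sub>1 = UNIV"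
    using assms(2,3) by (simp_all add: is_base_iff)
  have eq: "span B\<^sub>0 = span B\<^sub>1" using B(3,4) by simp
  have X: "disjoint_family_on X (Field \<kappa>)" "(\<Union>k\<in>Field \<kappa>. X k) = B\<^sub>0"
    using assms(5) by (simp_all add: indexed_partition_def)
  have wo: "Well_order \<kappa>" using assms(4) by (rule card_order_on_well_order_on)
  obtain Y where "disjoint_family_on Y (Field \<kappa>)" "(\<Union>k\<in>Field \<kappa>. Y k) = B\<^sub>1"
    "\<And>k. k \<in> Field \<kappa> \<Longrightarrow> indep {} ((B\<^sub>0 - X k) \<union> Y k)"
    "\<And>k. k \<in> Field \<kappa> \<Longrightarrow> span ((B\<^sub>0 - X k) \<union> Y k) = span B\<^sub>0"
    by (rule partition_exchange[OF B(1,2) eq wo assms(6) X]) (assumption, (rule that; assumption))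
  then show ?thesis
    using B(3) by (intro exI[of _ Y]) (simp add: indexed_partition_def is_base_iff)
qed

end
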